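(* Let $\mathcal A=(a_{ij})$, $\mathcal B=(b_{ij})$ be symmetric $3\times3$ matrices (indices $0,1,2$) with generic entries, let $\mathbf V(u,v)=(u^2,uv,v^2)^T$ and $\mathbf f(u)=(\mathcal A\mathbf V(u,1))\times(\mathcal B\mathbf V(u,1))$ with components $f^{(1)},f^{(2)},f^{(3)}$. Consider the symmetric QRT map given by the recurrence $$u_{n+1}=\frac{f^{(1)}(u_n)-u_{n-1}f^{(2)}(u_n)}{f^{(2)}(u_n)-u_{n-1}f^{(3)}(u_n)}.$$ Then for every $n\ge0$, the iterate $u_n$, regarded as a rational function of the initial values $u_0,u_1$, has degree $2n^2-2n+1$.
   Context: "Generic" means e.g. that the 12 independent entries $a_{ij},b_{ij}$ ($i\le j$) are independent indeterminates. The degree of a rational function in $u_0,u_1$ is the maximum of the total degrees of the numerator and denominator when it is written as a ratio of coprime polynomials. *)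

theory Defs
  imports "HOL-Library.Poly_Mapping" "HOL-Computational_Algebra.Polynomial"
          "HOL-Computational_Algebra.Fraction_Field"
begin

text \<open>Coefficient field: Q(x_0, x_1, ...), rational functions over Q in independent
  indeterminates x_k (multivariate polynomials realised as poly_mappings).\<close>
type_synonym coef = "((nat \<Rightarrow>\<^sub>0 nat) \<Rightarrow>\<^sub>0 rat) fract"

definition indet :: "nat \<Rightarrow> coef" where
  "indet k = Fract (Poly_Mapping.single (Poly_Mapping.single k 1) 1) 1"

text \<open>Index of the symmetric entry (i,j), i,j in {0,1,2}; distinct for distinct unordered pairs.\<close>
definition sym_idx :: "nat \<Rightarrow> nat \<Rightarrow> nat" where
  "sym_idx i j = (if i \<le> j then 3 * i + j else 3 * j + i)"

text \<open>Generic symmetric matrices: the 12 entries a_ij, b_ij (i \<le> j) are distinct indeterminates.\<close>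
definition matA :: "nat \<Rightarrow> nat \<Rightarrow> coef" where
  "matA i j = indet (sym_idx i j)"

definition matB :: "nat \<Rightarrow> nat \<Rightarrow> coef" where
  "matB i j = indet (9 + sym_idx i j)"

text \<open>Polynomials in u0,u1 over coef: outer variable u1, inner variable u0;
  the rational functions in u0,u1 are the fraction field of this ring.\<close>
type_synonym bipoly = "coef poly poly"
type_synonym ratfun = "bipoly fract"

definition U0 :: ratfun where "U0 = Fract [:[:0, 1:]:] 1"
definition U1 :: ratfun where "U1 = Fract [:0, 1:] 1"
definition cst :: "coef \<Rightarrow> ratfun" where "cst c = Fract [:[:c:]:] 1"

definition Vvec :: "ratfun \<Rightarrow> nat \<Rightarrow> ratfun" where
  "Vvec u k = (if k = 0 then u ^ 2 else if k = 1 then u else 1)"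

definition matvec :: "(nat \<Rightarrow> nat \<Rightarrow> coef) \<Rightarrow> ratfun \<Rightarrow> nat \<Rightarrow> ratfun" where
  "matvec M u i = (\<Sum>j<3. cst (M i j) * Vvec u j)"

text \<open>f(u) = (A V(u,1)) x (B V(u,1)); components f^(1), f^(2), f^(3).\<close>
definition f1 :: "ratfun \<Rightarrow> ratfun" where
  "f1 u = matvec matA u 1 * matvec matB u 2 - matvec matA u 2 * matvec matB u 1"
definition f2 :: "ratfun \<Rightarrow> ratfun" where
  "f2 u = matvec matA u 2 * matvec matB u 0 - matvec matA u 0 * matvec matB u 2"
definition f3 :: "ratfun \<Rightarrow> ratfun" where
  "f3 u = matvec matA u 0 * matvec matB u 1 - matvec matA u 1 * matvec matB u 0"

fun qrt :: "nat \<Rightarrow> ratfun" where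
  "qrt 0 = U0"
| "qrt (Suc 0) = U1"
| "qrt (Suc (Suc n)) =
     (let u = qrt (Suc n); w = qrt n in (f1 u - w * f2 u) / (f2 u - w * f3 u))"

definition tdeg :: "bipoly \<Rightarrow> nat" where
  "tdeg p = Max ({0} \<union> {degree (coeff p i) + i | i. coeff p i \<noteq> 0})"

definition rf_degree :: "ratfun \<Rightarrow> nat" where
  "rf_degree r = (THE d. \<exists>p q. q \<noteq> 0 \<and> coprime p q \<and> r = Fract p q \<and> d = max (tdeg p) (tdeg q))"

end

theory Submission
  imports Defs "HOL-Computational_Algebra.Polynomial_Factorial" "HOL-Computational_Algebra.Field_as_Ring"
begin

text \<open>Write \<open>u\<^sub>n = p\<^sub>n/q\<^sub>n\<close> in lowest terms over the polynomial ring in \<open>u\<^sub>0, u\<^sub>1\<close>, and let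
  \<open>S = V(u\<^sub>1)\<^sup>T A V(u\<^sub>0)\<close>, \<open>T = V(u\<^sub>1)\<^sup>T B V(u\<^sub>0)\<close>. The ratio \<open>S/T\<close> is a conserved quantity, so with
  \<open>V\<^sub>n = (p\<^sub>n\<^sup>2, p\<^sub>nq\<^sub>n, q\<^sub>n\<^sup>2)\<close> the quadratic form in \<open>(x : y)\<close> with coefficient vector
  \<open>T A V\<^sub>n - S B V\<^sub>n\<close> vanishes at both neighbours of \<open>u\<^sub>n\<close>, and it equals, up to sign, the product
  \<open>(x q' - y p')(x q'' - y p'')\<close> of the corresponding linear forms. For generic \<open>A, B\<close> no member of
  the pencil \<open>sA - tB\<close> has a kernel vector on the conic \<open>(p\<^sup>2, pq, q\<^sup>2)\<close>; hence this form has no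
  content and the new numerator and denominator are again coprime. Comparing degrees gives
  \<open>d'' + d' = 2d + 4\<close> for the degrees of three consecutive iterates, with \<open>d\<^sub>0 = d\<^sub>1 = 1\<close>. The
  genericity conditions say that certain polynomials in the 12 entries are nonzero, which is seen
  by evaluating them at suitable entries 0 and 1.\<close>

subsection \<open>Fraction fields are trivially factorial\<close>

text \<open>These field instances give \<open>coef poly poly\<close> its gcd and unique
  factorization, on which the coprimality arguments rest.\<close>

instantiation fract ::
  (idom) "{unique_euclidean_ring, normalization_euclidean_semiring, normalization_semidom_multiplicative}"
begin

definition [simp]: "normalize_fract = (normalize_field :: 'a fract \<Rightarrow> _)"
definition [simp]: "unit_factor_fract = (unit_factor_field :: 'a fract \<Rightarrow> _)"
definition [simp]: "modulo_fract = (mod_field :: 'a fract \<Rightarrow> _)"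
definition [simp]: "euclidean_size_fract = (euclidean_size_field :: 'a fract \<Rightarrow> _)"
definition [simp]: "division_segment (x :: 'a fract) = 1"

instance
  by standard
    (simp_all add: dvd_field_iff field_split_simps split: if_splits)

end

instantiation fract :: (idom) euclidean_ring_gcd
begin

definition gcd_fract :: "'a fract \<Rightarrow> 'a fract \<Rightarrow> 'a fract" where
  "gcd_fract = Euclidean_Algorithm.gcd"
definition lcm_fract :: "'a fract \<Rightarrow> 'a fract \<Rightarrow> 'a fract" where
  "lcm_fract = Euclidean_Algorithm.lcm"
definition Gcd_fract :: "'a fract set \<Rightarrow> 'a fract" where
 "Gcd_fract = Euclidean_Algorithm.Gcd"
definition Lcm_fract :: "'a fract set \<Rightarrow> 'a fract" where
 "Lcm_fract = Euclidean_Algorithm.Lcm"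

instance by standard (simp_all add: gcd_fract_def lcm_fract_def Gcd_fract_def Lcm_fract_def)

end

instance fract :: (idom) field_gcd ..

subsection \<open>Evaluation of multivariate polynomials\<close>

definition monom_eval :: "('v \<Rightarrow> 'a) \<Rightarrow> ('v \<Rightarrow>\<^sub>0 nat) \<Rightarrow> 'a::comm_ring_1" where
  "monom_eval \<psi> k = (\<Prod>i\<in>Poly_Mapping.keys k. \<psi> i ^ Poly_Mapping.lookup k i)"

definition mpoly_eval :: "('v \<Rightarrow> 'a) \<Rightarrow> (('v \<Rightarrow>\<^sub>0 nat) \<Rightarrow>\<^sub>0 'a) \<Rightarrow> 'a::comm_ring_1" where
  "mpoly_eval \<psi> p = (\<Sum>k\<in>Poly_Mapping.keys p. Poly_Mapping.lookup p k * monom_eval \<psi> k)"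

lemma monom_eval_add: "monom_eval \<psi> (k + l) = monom_eval \<psi> k * monom_eval \<psi> l"
proof -
  have sup: "monom_eval \<psi> m = (\<Prod>i\<in>Poly_Mapping.keys k \<union> Poly_Mapping.keys l. \<psi> i ^ Poly_Mapping.lookup m i)"
    if "Poly_Mapping.keys m \<subseteq> Poly_Mapping.keys k \<union> Poly_Mapping.keys l" for m
    unfolding monom_eval_def using that
    by (intro prod.mono_neutral_left) (auto simp: in_keys_iff)
  show ?thesis
    by (simp add: sup keys_add lookup_add power_add prod.distrib)
qed

lemma mpoly_eval_zero [simp]: "mpoly_eval \<psi> 0 = 0"
  by (simp add: mpoly_eval_def)

lemma mpoly_eval_one [simp]: "mpoly_eval \<psi> 1 = 1"
  by (simp add: mpoly_eval_def monom_eval_def lookup_one)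

lemma mpoly_eval_add [simp]: "mpoly_eval \<psi> (p + q) = mpoly_eval \<psi> p + mpoly_eval \<psi> q"
  unfolding mpoly_eval_def by (rule setsum_keys_plus_distrib) (auto simp: distrib_right)

lemma mpoly_eval_diff [simp]: "mpoly_eval \<psi> (p - q) = mpoly_eval \<psi> p - mpoly_eval \<psi> q"
  using mpoly_eval_add[of \<psi> "p - q" q] by (simp add: algebra_simps)

lemma mpoly_eval_single: "mpoly_eval \<psi> (Poly_Mapping.single k c) = c * monom_eval \<psi> k"
  by (simp add: mpoly_eval_def)

lemma poly_mapping_add_induct [case_names zero add]:
  assumes "P 0" and "\<And>k c p. P p \<Longrightarrow> P (Poly_Mapping.single k c + p)"
  shows "P (p :: 'k \<Rightarrow>\<^sub>0 'a::monoid_add)"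
proof (induction p rule: update_induct)
  case const
  then show ?case using assms(1) .
next
  case (update f a b)
  have "Poly_Mapping.update a b f = Poly_Mapping.single a b + f"
    using update.hyps(1)
    by (intro poly_mapping_eqI)
       (auto simp: lookup_update lookup_add lookup_single when_def in_keys_iff)
  then show ?case using assms(2) update.IH by simp
qed

lemma mpoly_eval_mult [simp]: "mpoly_eval \<psi> (p * q) = mpoly_eval \<psi> p * mpoly_eval \<psi> q"
proof (induction p rule: poly_mapping_add_induct)
  case (add k c p)
  have "mpoly_eval \<psi> (Poly_Mapping.single k c * q) = c * monom_eval \<psi> k * mpoly_eval \<psi> q"
    by (induction q rule: poly_mapping_add_induct)
       (simp_all add: mpoly_eval_single mult_single monom_eval_add algebra_simps)
  then show ?case using add by (simp add: mpoly_eval_single algebra_simps)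
qed simp

definition mvar :: "nat \<Rightarrow> (nat \<Rightarrow>\<^sub>0 nat) \<Rightarrow>\<^sub>0 rat" where
  "mvar k = Poly_Mapping.single (Poly_Mapping.single k 1) 1"

lemma mpoly_eval_mvar [simp]: "mpoly_eval \<psi> (mvar k) = \<psi> k"
  by (simp add: mvar_def mpoly_eval_single monom_eval_def)

lemma indet_eq_to_fract: "indet k = to_fract (mvar k)"
  by (simp add: indet_def mvar_def to_fract_def)

lemma matA_eq: "matA i j = to_fract (mvar (sym_idx i j))"
  and matB_eq: "matB i j = to_fract (mvar (9 + sym_idx i j))"
  by (simp_all add: matA_def matB_def indet_eq_to_fract)

subsection \<open>Symmetric 3x3 matrices\<close>

declare One_nat_def [simp del]

definition is_sym :: "(nat \<Rightarrow> nat \<Rightarrow> 'a) \<Rightarrow> bool" where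
  "is_sym M \<longleftrightarrow> M 1 0 = M 0 1 \<and> M 2 0 = M 0 2 \<and> M 2 1 = M 1 2"

text \<open>Column 0 comes from \<open>X\<close>, column 1 from \<open>Y\<close>, column 2 from
  \<open>Z\<close>; by multilinearity, \<open>det3\<close> of a pencil sA - tB expands into these
  mixed determinants.\<close>

definition det_cols ::
  "(nat \<Rightarrow> nat \<Rightarrow> 'a) \<Rightarrow> (nat \<Rightarrow> nat \<Rightarrow> 'a) \<Rightarrow> (nat \<Rightarrow> nat \<Rightarrow> 'a) \<Rightarrow> 'a::comm_ring_1" where
  "det_cols X Y Z = X 0 0 * (Y 1 1 * Z 2 2 - Y 2 1 * Z 1 2)
     - X 1 0 * (Y 0 1 * Z 2 2 - Y 2 1 * Z 0 2) + X 2 0 * (Y 0 1 * Z 1 2 - Y 1 1 * Z 0 2)"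

abbreviation det3 :: "(nat \<Rightarrow> nat \<Rightarrow> 'a) \<Rightarrow> 'a::comm_ring_1" where
  "det3 M \<equiv> det_cols M M M"

text \<open>For symmetric \<open>M\<close>, \<open>adj_skew M M\<close> is the (1,1) entry minus the
  (0,2) entry of the adjugate; two arguments make it bilinear, so that it expands on a
  pencil.\<close>

definition adj_skew :: "(nat \<Rightarrow> nat \<Rightarrow> 'a) \<Rightarrow> (nat \<Rightarrow> nat \<Rightarrow> 'a) \<Rightarrow> 'a::comm_ring_1" where
  "adj_skew X Y = X 0 0 * Y 2 2 - X 0 2 * Y 0 2 - X 0 1 * Y 1 2 + X 0 2 * Y 1 1"

text \<open>If \<open>(sA - tB)V = 0\<close> for some nonzero \<open>V = (p\<^sup>2, pq, q\<^sup>2)\<close>, then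
  \<open>det(sA - tB) = 0\<close> and the adjugate, being a multiple of \<open>V V\<^sup>T\<close>, has equal entries at
  \<open>(1,1)\<close> and \<open>(0,2)\<close>. These are a binary cubic \<open>d\<^sub>3s\<^sup>3 + d\<^sub>2s\<^sup>2t + d\<^sub>1st\<^sup>2 + d\<^sub>0t\<^sup>3\<close> and a binary
  quadratic \<open>e\<^sub>2s\<^sup>2 + e\<^sub>1st + e\<^sub>0t\<^sup>2\<close>; \<open>cubic_quadratic_res\<close> is the resultant of the quadratic with the
  pseudo-remainder \<open>(r\<^sub>1s + r\<^sub>0t)t\<^sup>2\<close> of the cubic, after removal of \<open>t\<^sup>2\<close>.\<close>

definition cubic_quadratic_res :: "'a \<Rightarrow> 'a \<Rightarrow> 'a \<Rightarrow> 'a \<Rightarrow> 'a \<Rightarrow> 'a \<Rightarrow> 'a \<Rightarrow> 'a::comm_ring_1" where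
  "cubic_quadratic_res d3 d2 d1 d0 e2 e1 e0 =
    (let g = e2 * d2 - d3 * e1;
         r1 = e2 * (e2 * d1 - d3 * e0) - g * e1; r0 = e2 ^ 2 * d0 - g * e0
     in e2 * r0 ^ 2 - e1 * r0 * r1 + e0 * r1 ^ 2)"

definition pencil_res :: "(nat \<Rightarrow> nat \<Rightarrow> 'a) \<Rightarrow> (nat \<Rightarrow> nat \<Rightarrow> 'a) \<Rightarrow> 'a::comm_ring_1" where
  "pencil_res A B = cubic_quadratic_res
     (det3 A) (- (det_cols B A A + det_cols A B A + det_cols A A B))
     (det_cols A B B + det_cols B A B + det_cols B B A) (- det3 B)
     (adj_skew A A) (- (adj_skew A B + adj_skew B A)) (adj_skew B B)"

text \<open>The Sylvester resultant of two binary quadratics, written in the 2x2 minors of their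
  coefficients.\<close>

definition quad_res :: "'a \<Rightarrow> 'a \<Rightarrow> 'a \<Rightarrow> 'a \<Rightarrow> 'a \<Rightarrow> 'a \<Rightarrow> 'a::comm_ring_1" where
  "quad_res a0 a1 a2 b0 b1 b2 =
    (a2 * b0 - a0 * b2) ^ 2 - (a1 * b2 - a2 * b1) * (a0 * b1 - a1 * b0)"

text \<open>\<open>A 0 0\<close> keeps the invariant form of \<open>A\<close> nonzero, the second
  determinant controls leading terms, the two \<open>quad_res\<close> conditions keep the quadratics
  of each step without a common root, and \<open>det3 A\<close>, \<open>adj_skew\<close>,
  \<open>pencil_res\<close> exclude common prime factors.\<close>

definition generic_pair :: "(nat \<Rightarrow> nat \<Rightarrow> 'a) \<Rightarrow> (nat \<Rightarrow> nat \<Rightarrow> 'a::comm_ring_1) \<Rightarrow> bool"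
  where "generic_pair A B \<longleftrightarrow> is_sym A \<and> is_sym B \<and> A 0 0 \<noteq> 0 \<and> det3 A \<noteq> 0 \<and>
    det3 (\<lambda>i j. B 0 0 * A i j - A 0 0 * B i j) \<noteq> 0 \<and>
    quad_res (A 0 0) (A 0 1) (A 0 2) (B 0 0) (B 0 1) (B 0 2) \<noteq> 0 \<and>
    quad_res (A 2 0) (A 2 1) (A 2 2) (B 2 0) (B 2 1) (B 2 2) \<noteq> 0 \<and>
    adj_skew A A \<noteq> 0 \<and> pencil_res A B \<noteq> 0"

lemma nonzero_if_mpoly_eval_nonzero:
  assumes "mpoly_eval \<psi> p \<noteq> 0"
  shows "p \<noteq> 0"
  using assms by auto

text \<open>All genericity conditions are polynomials in the entries, so they commute with
  evaluation, with the embedding into fractions and with constant polynomials.\<close>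

locale comm_ring_1_map =
  fixes h :: "'a::comm_ring_1 \<Rightarrow> 'b::comm_ring_1"
  assumes add: "h (x + y) = h x + h y" and mult: "h (x * y) = h x * h y" and one: "h 1 = 1"
begin

lemma zero: "h 0 = 0"
  using add[of 0 0] by simp

lemma diff: "h (x - y) = h x - h y"
  using add[of "x - y" y] by (simp add: algebra_simps)

lemma uminus: "h (- x) = - h x"
  using diff[of 0 x] by (simp add: zero)

lemma power: "h (x ^ n) = h x ^ n"
  by (induction n) (simp_all add: one mult)

lemma det_cols: "h (det_cols X Y Z) = det_cols (\<lambda>i j. h (X i j)) (\<lambda>i j. h (Y i j)) (\<lambda>i j. h (Z i j))"
  by (simp add: det_cols_def add mult diff)

lemma adj_skew: "h (adj_skew X Y) = adj_skew (\<lambda>i j. h (X i j)) (\<lambda>i j. h (Y i j))"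
  by (simp add: adj_skew_def add mult diff)

lemma cubic_quadratic_res: "h (cubic_quadratic_res d3 d2 d1 d0 e2 e1 e0) =
    cubic_quadratic_res (h d3) (h d2) (h d1) (h d0) (h e2) (h e1) (h e0)"
  by (simp add: cubic_quadratic_res_def Let_def add mult diff power)

lemma pencil_res: "h (pencil_res X Y) = pencil_res (\<lambda>i j. h (X i j)) (\<lambda>i j. h (Y i j))"
  by (simp only: pencil_res_def cubic_quadratic_res add uminus det_cols adj_skew)

lemma quad_res: "h (quad_res a0 a1 a2 b0 b1 b2) =
    quad_res (h a0) (h a1) (h a2) (h b0) (h b1) (h b2)"
  by (simp add: quad_res_def add mult diff power)

end

lemma comm_ring_1_map_mpoly_eval: "comm_ring_1_map (mpoly_eval \<psi>)"
  by unfold_locales simp_all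

lemma comm_ring_1_map_to_fract: "comm_ring_1_map to_fract"
  by unfold_locales simp_all

lemma generic_pair_matA_matB: "generic_pair matA matB"
proof -
  define X Y where "X = (\<lambda>i j. mvar (sym_idx i j))" and "Y = (\<lambda>i j. mvar (9 + sym_idx i j))"
  \<comment> \<open>The point \<open>\<psi> S\<close> sets the indeterminates with index in
    \<open>S\<close> to 1 and the others to 0: indices 0 to 8 belong to A, 9 to 17 to B. Each
    condition gets its own point.\<close>
  define \<psi> :: "nat set \<Rightarrow> nat \<Rightarrow> rat" where "\<psi> S = (\<lambda>k. of_bool (k \<in> S))" for S
  have mat: "matA = (\<lambda>i j. to_fract (X i j))" "matB = (\<lambda>i j. to_fract (Y i j))"
    by (simp_all add: fun_eq_iff matA_eq matB_eq X_def Y_def)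
  have ev: "mpoly_eval (\<psi> S) (X i j) = of_bool (sym_idx i j \<in> S)"
    "mpoly_eval (\<psi> S) (Y i j) = of_bool (9 + sym_idx i j \<in> S)" for S i j
    by (simp_all add: X_def Y_def \<psi>_def)
  note homs = comm_ring_1_map.det_cols comm_ring_1_map.adj_skew comm_ring_1_map.pencil_res
    comm_ring_1_map.quad_res
  note to_fract_homs = homs[OF comm_ring_1_map_to_fract]
  note ev_homs = homs[OF comm_ring_1_map_mpoly_eval]
  note simps = sym_idx_def det_cols_def adj_skew_def quad_res_def
  have "X 0 0 \<noteq> 0"
    by (rule nonzero_if_mpoly_eval_nonzero[where \<psi> = "\<psi> {0}"]) (simp add: ev simps)
  moreover have "det3 X \<noteq> 0"
    by (rule nonzero_if_mpoly_eval_nonzero[where \<psi> = "\<psi> {0,4,8}"]) (simp only: ev_homs ev, simp add: simps)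
  \<comment> \<open>Here A is the antidiagonal permutation matrix and the only nonzero entry of B is
    at (0,0), so the matrix in question is A itself.\<close>
  moreover have "det3 (\<lambda>i j. Y 0 0 * X i j - X 0 0 * Y i j) \<noteq> 0"
    by (rule nonzero_if_mpoly_eval_nonzero[where \<psi> = "\<psi> {2,4,9}"])
       (simp only: ev_homs ev mpoly_eval_mult mpoly_eval_diff, simp add: simps)
  moreover have "quad_res (X 0 0) (X 0 1) (X 0 2) (Y 0 0) (Y 0 1) (Y 0 2) \<noteq> 0"
    by (rule nonzero_if_mpoly_eval_nonzero[where \<psi> = "\<psi> {0,11}"]) (simp only: ev_homs ev, simp add: simps)
  moreover have "quad_res (X 2 0) (X 2 1) (X 2 2) (Y 2 0) (Y 2 1) (Y 2 2) \<noteq> 0"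
    by (rule nonzero_if_mpoly_eval_nonzero[where \<psi> = "\<psi> {2,17}"]) (simp only: ev_homs ev, simp add: simps)
  moreover have "adj_skew X X \<noteq> 0"
    by (rule nonzero_if_mpoly_eval_nonzero[where \<psi> = "\<psi> {0,8}"]) (simp only: ev_homs ev, simp add: simps)
  moreover have "pencil_res X Y \<noteq> 0"
  proof (rule nonzero_if_mpoly_eval_nonzero)
    \<comment> \<open>With A = diag(1,0,1) and B antidiagonal, the cubic is t^3 - s^2 t and the
      quadratic is s^2; they have no common projective zero.\<close>
    define P Q where "P = (\<lambda>i j. mpoly_eval (\<psi> {0,8,11,13}) (X i j))"
      and "Q = (\<lambda>i j. mpoly_eval (\<psi> {0,8,11,13}) (Y i j))"
    have "P 0 0 = 1" "P 0 1 = 0" "P 0 2 = 0" "P 1 0 = 0" "P 1 1 = 0" "P 1 2 = 0"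
      "P 2 0 = 0" "P 2 1 = 0" "P 2 2 = 1" "Q 0 0 = 0" "Q 0 1 = 0" "Q 0 2 = 1" "Q 1 0 = 0"
      "Q 1 1 = 1" "Q 1 2 = 0" "Q 2 0 = 1" "Q 2 1 = 0" "Q 2 2 = 0"
      by (simp_all add: P_def Q_def ev sym_idx_def)
    then have "pencil_res P Q \<noteq> 0"
      by (simp add: pencil_res_def det_cols_def adj_skew_def cubic_quadratic_res_def)
    then show "mpoly_eval (\<psi> {0,8,11,13}) (pencil_res X Y) \<noteq> 0"
      by (simp only: ev_homs P_def Q_def not_False_eq_True)
  qed
  moreover have "is_sym matA" "is_sym matB"
    by (simp_all add: is_sym_def matA_def matB_def sym_idx_def)
  moreover have "det3 matA = to_fract (det3 X)" "adj_skew matA matA = to_fract (adj_skew X X)"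
    "pencil_res matA matB = to_fract (pencil_res X Y)"
    "det3 (\<lambda>i j. matB 0 0 * matA i j - matA 0 0 * matB i j)
       = to_fract (det3 (\<lambda>i j. Y 0 0 * X i j - X 0 0 * Y i j))"
    "quad_res (matA 0 0) (matA 0 1) (matA 0 2) (matB 0 0) (matB 0 1) (matB 0 2)
      = to_fract (quad_res (X 0 0) (X 0 1) (X 0 2) (Y 0 0) (Y 0 1) (Y 0 2))"
    "quad_res (matA 2 0) (matA 2 1) (matA 2 2) (matB 2 0) (matB 2 1) (matB 2 2)
      = to_fract (quad_res (X 2 0) (X 2 1) (X 2 2) (Y 2 0) (Y 2 1) (Y 2 2))"
    by (simp_all only: mat to_fract_homs to_fract_mult to_fract_diff)
  moreover have "matA 0 0 = to_fract (X 0 0)"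
    by (simp add: mat)
  ultimately show ?thesis
    by (simp only: generic_pair_def to_fract_eq_0_iff simp_thms)
qed

subsection \<open>The recurrence over a factorial ring\<close>

definition quad_vec :: "(nat \<Rightarrow> nat \<Rightarrow> 'a) \<Rightarrow> 'a \<Rightarrow> 'a \<Rightarrow> nat \<Rightarrow> 'a::comm_ring_1" where
  "quad_vec M p q i = M i 0 * p ^ 2 + M i 1 * (p * q) + M i 2 * q ^ 2"

definition biquad :: "(nat \<Rightarrow> nat \<Rightarrow> 'a) \<Rightarrow> 'a \<Rightarrow> 'a \<Rightarrow> 'a \<Rightarrow> 'a \<Rightarrow> 'a::comm_ring_1" where
  "biquad M p q x y = quad_vec M p q 0 * x ^ 2 + quad_vec M p q 1 * (x * y) + quad_vec M p q 2 * y ^ 2"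

lemma biquad_commute:
  assumes "is_sym M"
  shows "biquad M p q x y = biquad M x y p q"
proof -
  have sym: "M 1 0 = M 0 1" "M 2 0 = M 0 2" "M 2 1 = M 1 2"
    using assms by (auto simp: is_sym_def)
  show ?thesis
    by (simp add: biquad_def quad_vec_def sym algebra_simps)
qed

section \<open>Common prime divisors and the pencil of symmetric matrices\<close>

lemma dvd_coprime_multiples:
  fixes a b c n :: "'a::semiring_gcd"
  assumes "coprime a b" "c dvd a * n" "c dvd b * n"
  shows "c dvd n"
proof -
  have "c dvd gcd (a * n) (b * n)" using assms by simp
  then show ?thesis using assms(1) by (simp add: gcd_mult_right coprime_iff_gcd_eq_1 gcd.commute)
qed

text \<open>Pseudo-division leaves t^2 times a linear form \<open>L\<close>. If \<open>\<pi>\<close>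
  did not divide \<open>t\<close>, it would divide \<open>L\<close>, and eliminating
  \<open>s\<close> from \<open>L\<close> and the quadratic would make it divide the resultant. Once
  \<open>\<pi>\<close> divides \<open>t\<close>, the quadratic leaves only
  \<open>e2 * s ^ 2\<close>.\<close>

lemma prime_dvd_quadratic_cubic:
  fixes s t \<pi> :: "'a::idom"
  assumes "prime_elem \<pi>"
    and "\<pi> dvd d3 * s ^ 3 + d2 * s ^ 2 * t + d1 * s * t ^ 2 + d0 * t ^ 3"
    and "\<pi> dvd e2 * s ^ 2 + e1 * s * t + e0 * t ^ 2"
    and "\<not> \<pi> dvd e2"
    and res: "\<not> \<pi> dvd cubic_quadratic_res d3 d2 d1 d0 e2 e1 e0"
  shows "\<pi> dvd s \<and> \<pi> dvd t"
proof -
  define g where g: "g = e2 * d2 - d3 * e1"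
  define r1 where r1: "r1 = e2 * (e2 * d1 - d3 * e0) - g * e1"
  define r0 where r0: "r0 = e2 ^ 2 * d0 - g * e0"
  have res': "\<not> \<pi> dvd e2 * r0 ^ 2 - e1 * r0 * r1 + e0 * r1 ^ 2"
    using res by (simp add: cubic_quadratic_res_def Let_def g r1 r0)
  define D E where "D = d3 * s ^ 3 + d2 * s ^ 2 * t + d1 * s * t ^ 2 + d0 * t ^ 3"
    and "E = e2 * s ^ 2 + e1 * s * t + e0 * t ^ 2"
  have dvd: "\<pi> dvd D" "\<pi> dvd E"
    using assms by (simp_all add: D_def E_def)
  define L where "L = r1 * s + r0 * t"
  have "L * t ^ 2 = e2 * (e2 * D - d3 * s * E) - g * t * E"
    unfolding L_def D_def E_def r1 r0 g by algebra
  then have 1: "\<pi> dvd L * t ^ 2"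
    using dvd by simp
  have \<rho>: "(e2 * r0 ^ 2 - e1 * r0 * r1 + e0 * r1 ^ 2) * t ^ 2
      = r1 ^ 2 * E - (e2 * (r1 * s - r0 * t) + e1 * r1 * t) * L"
    unfolding L_def E_def by algebra
  have t: "\<pi> dvd t"
  proof (rule ccontr)
    assume "\<not> \<pi> dvd t"
    with 1 have "\<pi> dvd L"
      using assms(1) by (metis prime_elem_dvd_mult_iff prime_elem_dvd_power)
    then have "\<pi> dvd (e2 * r0 ^ 2 - e1 * r0 * r1 + e0 * r1 ^ 2) * t ^ 2"
      unfolding \<rho> using dvd by simp
    then show False
      using assms(1) res' \<open>\<not> \<pi> dvd t\<close> by (metis prime_elem_dvd_mult_iff prime_elem_dvd_power)
  qed
  have "e2 * s ^ 2 = E - t * (e1 * s + e0 * t)"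
    unfolding E_def by algebra
  then have "\<pi> dvd e2 * s ^ 2"
    using dvd t by simp
  then show ?thesis
    using assms(1,4) t by (metis prime_elem_dvd_mult_iff prime_elem_dvd_power)
qed

text \<open>The first and last rows of adj(M) M V = det(M) V for V = (p^2, pq, q^2).\<close>

lemma det3_mult_quad_vec:
  fixes M :: "nat \<Rightarrow> nat \<Rightarrow> 'a::idom"
  shows "det3 M * p ^ 2 = (M 1 1 * M 2 2 - M 2 1 * M 1 2) * quad_vec M p q 0
      - (M 0 1 * M 2 2 - M 2 1 * M 0 2) * quad_vec M p q 1
      + (M 0 1 * M 1 2 - M 1 1 * M 0 2) * quad_vec M p q 2"
    and "det3 M * q ^ 2 = (M 1 0 * M 2 1 - M 2 0 * M 1 1) * quad_vec M p q 0
      - (M 0 0 * M 2 1 - M 2 0 * M 0 1) * quad_vec M p q 1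
      + (M 0 0 * M 1 1 - M 1 0 * M 0 1) * quad_vec M p q 2"
  unfolding det_cols_def quad_vec_def by algebra+

text \<open>Division-free form of the fact that M V = 0 makes the adjugate a multiple of V V^T: the
  right-hand sides are combinations of the entries of M V.\<close>

lemma adj_skew_mult_quad_vec:
  fixes M :: "nat \<Rightarrow> nat \<Rightarrow> 'a::idom"
  assumes "is_sym M"
  shows "adj_skew M M * p ^ 4 = p ^ 2 * (M 2 2 * quad_vec M p q 0 - M 0 2 * quad_vec M p q 2)
      - p ^ 2 * (M 1 2 * quad_vec M p q 1 - M 1 1 * quad_vec M p q 2)
      - p * q * (M 2 2 * quad_vec M p q 1 - M 1 2 * quad_vec M p q 2)"
    and "adj_skew M M * q ^ 4 = q ^ 2 * (M 0 0 * quad_vec M p q 2 - M 0 2 * quad_vec M p q 0)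
      - q ^ 2 * (M 0 1 * quad_vec M p q 1 - M 1 1 * quad_vec M p q 0)
      - p * q * (M 0 0 * quad_vec M p q 1 - M 0 1 * quad_vec M p q 0)"
proof -
  have sym: "M 1 0 = M 0 1" "M 2 0 = M 0 2" "M 2 1 = M 1 2"
    using assms by (auto simp: is_sym_def)
  show "adj_skew M M * p ^ 4 = p ^ 2 * (M 2 2 * quad_vec M p q 0 - M 0 2 * quad_vec M p q 2)
      - p ^ 2 * (M 1 2 * quad_vec M p q 1 - M 1 1 * quad_vec M p q 2)
      - p * q * (M 2 2 * quad_vec M p q 1 - M 1 2 * quad_vec M p q 2)"
    unfolding adj_skew_def quad_vec_def sym by algebra
  show "adj_skew M M * q ^ 4 = q ^ 2 * (M 0 0 * quad_vec M p q 2 - M 0 2 * quad_vec M p q 0)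
      - q ^ 2 * (M 0 1 * quad_vec M p q 1 - M 1 1 * quad_vec M p q 0)
      - p * q * (M 0 0 * quad_vec M p q 1 - M 0 1 * quad_vec M p q 0)"
    unfolding adj_skew_def quad_vec_def sym by algebra
qed

text \<open>Modulo \<open>\<pi>\<close>, the nonzero vector (p^2, pq, q^2) lies in the kernel of sA
  - tB, so the cubic and the quadratic both vanish at (s, t), which the resultant allows only at (0,
  0).\<close>

lemma prime_dvd_pencil:
  fixes A B :: "nat \<Rightarrow> nat \<Rightarrow> 'a::idom"
  assumes \<pi>: "prime_elem \<pi>" and sym: "is_sym A" "is_sym B"
    and ndvd: "\<not> \<pi> dvd adj_skew A A" "\<not> \<pi> dvd pencil_res A B"
    and pq: "\<not> (\<pi> dvd p \<and> \<pi> dvd q)"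
    and vec: "\<And>i. i < 3 \<Longrightarrow> \<pi> dvd s * quad_vec A p q i - t * quad_vec B p q i"
  shows "\<pi> dvd s \<and> \<pi> dvd t"
proof -
  define M where "M = (\<lambda>i j. s * A i j - t * B i j)"
  have "is_sym M"
    using sym by (simp add: M_def is_sym_def)
  have "quad_vec M p q i = s * quad_vec A p q i - t * quad_vec B p q i" for i
    unfolding quad_vec_def M_def by algebra
  then have qv: "\<pi> dvd quad_vec M p q 0" "\<pi> dvd quad_vec M p q 1" "\<pi> dvd quad_vec M p q 2"
    using vec by simp_all
  have "\<pi> dvd det3 M * p ^ 2" "\<pi> dvd det3 M * q ^ 2"
    unfolding det3_mult_quad_vec[where p = p and q = q] using qv by simp_all
  then have D: "\<pi> dvd det3 M"
    using \<pi> pq by (metis prime_elem_dvd_mult_iff prime_elem_dvd_power)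
  have "\<pi> dvd adj_skew M M * p ^ 4" "\<pi> dvd adj_skew M M * q ^ 4"
    unfolding adj_skew_mult_quad_vec[OF \<open>is_sym M\<close>, where p = p and q = q] using qv by simp_all
  then have E: "\<pi> dvd adj_skew M M"
    using \<pi> pq by (metis prime_elem_dvd_mult_iff prime_elem_dvd_power)
  have detM: "det3 M = det3 A * s ^ 3
      + - (det_cols B A A + det_cols A B A + det_cols A A B) * s ^ 2 * t
      + (det_cols A B B + det_cols B A B + det_cols B B A) * s * t ^ 2 + - det3 B * t ^ 3"
    unfolding det_cols_def M_def by algebra
  have adjM: "adj_skew M M = adj_skew A A * s ^ 2 + - (adj_skew A B + adj_skew B A) * s * t
      + adj_skew B B * t ^ 2"
    unfolding adj_skew_def M_def by algebra
  show ?thesis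
    by (rule prime_dvd_quadratic_cubic[OF \<pi> D[unfolded detM] E[unfolded adjM] ndvd(1)])
       (use ndvd(2) in \<open>simp add: pencil_res_def\<close>)
qed

definition minor :: "nat \<Rightarrow> nat \<Rightarrow> (nat \<Rightarrow> nat \<Rightarrow> 'a) \<Rightarrow> (nat \<Rightarrow> nat \<Rightarrow> 'a) \<Rightarrow> 'a \<Rightarrow> 'a \<Rightarrow> 'a::comm_ring_1"
  where "minor i j A B p q =
    quad_vec A p q i * quad_vec B p q j - quad_vec A p q j * quad_vec B p q i"

text \<open>Vanishing minors make A V and B V parallel modulo \<open>\<pi>\<close>. For each j, the
  pencil member with s = (B V)_j, t = (A V)_j then kills V, so every (A V)_j vanishes, against the
  determinant of A.\<close>

lemma prime_dvd_minors:
  fixes A B :: "nat \<Rightarrow> nat \<Rightarrow> 'a::idom"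
  assumes \<pi>: "prime_elem \<pi>" and sym: "is_sym A" "is_sym B"
    and ndvd: "\<not> \<pi> dvd adj_skew A A" "\<not> \<pi> dvd pencil_res A B" "\<not> \<pi> dvd det3 A"
    and minors: "\<pi> dvd minor 1 2 A B p q" "\<pi> dvd minor 2 0 A B p q" "\<pi> dvd minor 0 1 A B p q"
  shows "\<pi> dvd p \<and> \<pi> dvd q"
proof (rule ccontr)
  assume pq: "\<not> (\<pi> dvd p \<and> \<pi> dvd q)"
  have less3: "i = 0 \<or> i = 1 \<or> i = 2" if "i < 3" for i :: nat
    using that by linarith
  have skew: "minor i j A B p q = - minor j i A B p q" for i j
    unfolding minor_def by algebra
  have "\<pi> dvd minor i j A B p q" if "i < 3" "j < 3" for i j
  proof -
    have "minor i i A B p q = 0" for i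
      unfolding minor_def by algebra
    moreover have "\<pi> dvd minor 2 1 A B p q" "\<pi> dvd minor 0 2 A B p q" "\<pi> dvd minor 1 0 A B p q"
      using minors skew[of 2 1] skew[of 0 2] skew[of 1 0] by auto
    ultimately show ?thesis
      using minors less3[OF that(1)] less3[OF that(2)] by auto
  qed
  then have "\<pi> dvd quad_vec B p q j * quad_vec A p q i - quad_vec A p q j * quad_vec B p q i"
    if "i < 3" "j < 3" for i j
    using that unfolding minor_def by (simp add: mult.commute)
  from prime_dvd_pencil[OF \<pi> sym ndvd(1,2) pq this]
  have "\<pi> dvd quad_vec A p q j" if "j < 3" for j
    using that by blast
  then have "\<pi> dvd quad_vec A p q 0" "\<pi> dvd quad_vec A p q 1" "\<pi> dvd quad_vec A p q 2"
    by simp_all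
  then have "\<pi> dvd det3 A * p ^ 2" "\<pi> dvd det3 A * q ^ 2"
    unfolding det3_mult_quad_vec[where p = p and q = q] by simp_all
  then show False
    using \<pi> pq ndvd(3) by (metis prime_elem_dvd_mult_iff prime_elem_dvd_power)
qed

lemma coprime_if_no_prime:
  fixes a b :: "'a::factorial_semiring"
  assumes "a \<noteq> 0 \<or> b \<noteq> 0" and "\<And>\<pi>. prime_elem \<pi> \<Longrightarrow> \<pi> dvd a \<Longrightarrow> \<pi> dvd b \<Longrightarrow> False"
  shows "coprime a b"
proof (rule coprimeI)
  fix c assume c: "c dvd a" "c dvd b"
  show "is_unit c"
  proof (rule ccontr)
    assume "\<not> is_unit c"
    moreover have "c \<noteq> 0" using assms(1) c by auto
    ultimately obtain \<pi> where "\<pi> dvd c" "prime \<pi>"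
      using prime_divisor_exists by blast
    then show False using assms(2)[of \<pi>] c dvd_trans by blast
  qed
qed

text \<open>\<open>N\<^sub>1/N\<^sub>2\<close> is the unreduced next iterate. With \<open>a = A V(p,q)\<close>, \<open>b = B V(p,q)\<close>, the quadratic form
  \<open>a(x) b(w) - b(x) a(w)\<close> vanishes at the old iterate \<open>w = (p' : q')\<close> and hence splits; by Gauss' lemma
  the common factor \<open>G\<close> of \<open>a(w)\<close> and \<open>b(w)\<close> divides \<open>N\<^sub>1\<close> and \<open>N\<^sub>2\<close>, and it is their whole gcd.\<close>

lemma qrt_step:
  fixes A B :: "nat \<Rightarrow> nat \<Rightarrow> 'a::factorial_ring_gcd"
  assumes sym: "is_sym A" "is_sym B"
    and units: "is_unit (adj_skew A A)" "is_unit (pencil_res A B)" "is_unit (det3 A)"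
    and cop: "coprime p q" "coprime p' q'" "coprime S T"
    and nz: "S \<noteq> 0" "G \<noteq> 0"
    and inv: "biquad A p q p' q' = G * S" "biquad B p q p' q' = G * T"
    and res: "minor 2 0 A B p q ^ 2 - minor 1 2 A B p q * minor 0 1 A B p q \<noteq> 0"
  obtains p'' q'' G'' where "coprime p'' q''" "G'' \<noteq> 0"
    "biquad A p'' q'' p q = G'' * S" "biquad B p'' q'' p q = G'' * T"
    "G * p'' = minor 1 2 A B p q * q' - p' * minor 2 0 A B p q"
    "G * q'' = minor 2 0 A B p q * q' - p' * minor 0 1 A B p q"
    "quad_vec A p q 0 * T - quad_vec B p q 0 * S = - (q' * q'')"
    "quad_vec A p q 1 * T - quad_vec B p q 1 * S = q' * p'' + p' * q''"
    "quad_vec A p q 2 * T - quad_vec B p q 2 * S = - (p' * p'')"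
proof -
  define a0 a1 a2 b0 b1 b2 where ab: "a0 = quad_vec A p q 0" "a1 = quad_vec A p q 1"
    "a2 = quad_vec A p q 2" "b0 = quad_vec B p q 0" "b1 = quad_vec B p q 1" "b2 = quad_vec B p q 2"
  define F1 F2 F3 where F: "F1 = minor 1 2 A B p q" "F2 = minor 2 0 A B p q" "F3 = minor 0 1 A B p q"
  have F': "F1 = a1 * b2 - a2 * b1" "F2 = a2 * b0 - a0 * b2" "F3 = a0 * b1 - a1 * b0"
    by (simp_all add: F ab minor_def)
  define N1 N2 where N: "N1 = F1 * q' - p' * F2" "N2 = F2 * q' - p' * F3"
  have inv': "a0 * p' ^ 2 + a1 * (p' * q') + a2 * q' ^ 2 = G * S"
    "b0 * p' ^ 2 + b1 * (p' * q') + b2 * q' ^ 2 = G * T"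
    using inv by (simp_all add: biquad_def ab)
  \<comment> \<open>By \<open>inv'\<close>, the left sides are the coefficients of a(x) b(w) - b(x)
    a(w) = -(x q' - y p')(x N2 - y N1), where w = (p' : q').\<close>
  have C0: "G * (a0 * T - b0 * S) = - (q' * N2)"
    using inv' unfolding N F' by algebra
  have C1: "G * (a1 * T - b1 * S) = q' * N1 + p' * N2"
    using inv' unfolding N F' by algebra
  have C2: "G * (a2 * T - b2 * S) = - (p' * N1)"
    using inv' unfolding N F' by algebra
  have "G dvd q' * N2" "G dvd p' * N1" and G1: "G dvd q' * N1 + p' * N2"
    using C0 C1 C2 by (metis dvd_minus_iff dvd_triv_left)+
  \<comment> \<open>Gauss' lemma by hand: \<open>G\<close> divides both \<open>q' ^ 2 * N1\<close>
    and \<open>p' * N1\<close>, hence \<open>N1\<close>, and \<open>N2\<close>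
    symmetrically.\<close>
  have "q' ^ 2 * N1 = q' * (q' * N1 + p' * N2) - p' * (q' * N2)"
    by algebra
  then have "G dvd q' ^ 2 * N1"
    using G1 \<open>G dvd q' * N2\<close> by simp
  then have "G dvd N1"
    using \<open>G dvd p' * N1\<close> cop(2) dvd_coprime_multiples[of p' "q' ^ 2" G N1] by simp
  have "p' ^ 2 * N2 = p' * (q' * N1 + p' * N2) - q' * (p' * N1)"
    by algebra
  then have "G dvd p' ^ 2 * N2"
    using G1 \<open>G dvd p' * N1\<close> by simp
  then have "G dvd N2"
    using \<open>G dvd q' * N2\<close> cop(2) dvd_coprime_multiples[of "p' ^ 2" q' G N2] by simp
  from \<open>G dvd N1\<close> \<open>G dvd N2\<close> obtain p'' q'' where pq'': "N1 = G * p''" "N2 = G * q''"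
    by (auto elim!: dvdE)
  have D0: "a0 * T - b0 * S = - (q' * q'')"
    using C0 nz(2) unfolding pq'' by algebra
  have D1: "a1 * T - b1 * S = q' * p'' + p' * q''"
    using C1 nz(2) unfolding pq'' by algebra
  have D2: "a2 * T - b2 * S = - (p' * p'')"
    using C2 nz(2) unfolding pq'' by algebra
  \<comment> \<open>The minors times \<open>S\<close> or \<open>T\<close> are combinations of the
    entries of aT - bS; a prime dividing these entries therefore divides all minors, since
    \<open>S\<close> and \<open>T\<close> are coprime.\<close>
  have SF: "S * F1 = a1 * (b2 * S - a2 * T) - a2 * (b1 * S - a1 * T)"
    "S * F2 = a2 * (b0 * S - a0 * T) - a0 * (b2 * S - a2 * T)"
    "S * F3 = a0 * (b1 * S - a1 * T) - a1 * (b0 * S - a0 * T)"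
    "T * F1 = b2 * (a1 * T - b1 * S) - b1 * (a2 * T - b2 * S)"
    "T * F2 = b0 * (a2 * T - b2 * S) - b2 * (a0 * T - b0 * S)"
    "T * F3 = b1 * (a0 * T - b0 * S) - b0 * (a1 * T - b1 * S)"
    unfolding F' by algebra+
  have "coprime p'' q''"
  proof (rule coprime_if_no_prime)
    show "p'' \<noteq> 0 \<or> q'' \<noteq> 0"
    proof (rule ccontr)
      assume "\<not> (p'' \<noteq> 0 \<or> q'' \<noteq> 0)"
      then have "a0 * T = b0 * S" "a1 * T = b1 * S" "a2 * T = b2 * S"
        using D0 D1 D2 by simp_all
      then have "S * F1 = 0" "S * F2 = 0"
        unfolding SF by simp_all
      then show False
        using nz res by (simp add: F)
    qed
  next
    fix \<pi> assume \<pi>: "prime_elem \<pi>" "\<pi> dvd p''" "\<pi> dvd q''"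
    then have d: "\<pi> dvd a0 * T - b0 * S" "\<pi> dvd a1 * T - b1 * S" "\<pi> dvd a2 * T - b2 * S"
      unfolding D0 D1 D2 by simp_all
    then have d': "\<pi> dvd b0 * S - a0 * T" "\<pi> dvd b1 * S - a1 * T" "\<pi> dvd b2 * S - a2 * T"
      by (metis dvd_minus_iff minus_diff_eq)+
    have "\<pi> dvd S * F1" "\<pi> dvd S * F2" "\<pi> dvd S * F3" "\<pi> dvd T * F1" "\<pi> dvd T * F2" "\<pi> dvd T * F3"
      unfolding SF using d d' by simp_all
    moreover have "\<not> (\<pi> dvd S \<and> \<pi> dvd T)"
      using cop(3) \<pi>(1) by (meson coprime_def prime_elem_def)
    ultimately have "\<pi> dvd F1" "\<pi> dvd F2" "\<pi> dvd F3"
      using \<pi>(1) prime_elem_dvd_mult_iff by blast+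
    moreover have "\<not> \<pi> dvd u" if "is_unit u" for u
      using that \<pi>(1) dvd_unit_imp_unit prime_elem_not_unit by blast
    ultimately have "\<pi> dvd p \<and> \<pi> dvd q"
      using prime_dvd_minors[OF \<pi>(1) sym] units unfolding F by blast
    then show False
      using cop(1) \<pi>(1) by (meson coprime_def prime_elem_def)
  qed
  \<comment> \<open>The old quadratics at the new point. That point is a root of a(x) T - b(x) S, so
    the two values stand in the ratio S : T, which yields the next factor
    \<open>G''\<close>.\<close>
  define a b where ab': "a = a0 * p'' ^ 2 + a1 * (p'' * q'') + a2 * q'' ^ 2"
    "b = b0 * p'' ^ 2 + b1 * (p'' * q'') + b2 * q'' ^ 2"
  have "a * T = b * S"
    using D0 D1 D2 unfolding ab' by algebra
  then have "S dvd a"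
    using cop(3) by (metis coprime_dvd_mult_left_iff dvd_triv_right)
  then obtain G'' where a: "a = G'' * S"
    by (metis dvdE mult.commute)
  with \<open>a * T = b * S\<close> have b: "b = G'' * T"
    using nz(1) by (simp add: mult.assoc mult.commute)
  have "G'' \<noteq> 0"
  proof
    assume "G'' = 0"
    then have 0: "a = 0" "b = 0"
      using a b by simp_all
    \<comment> \<open>If both quadratics vanished at the new point, they would share a root and
      their resultant would be zero, contrary to \<open>res\<close>.\<close>
    define M1 M2 where M: "M1 = F1 * q'' - p'' * F2" "M2 = F2 * q'' - p'' * F3"
    have "q'' * M2 = 0" "p'' * M1 = 0" "q'' * M1 + p'' * M2 = 0"
      using 0 unfolding ab' M F' by algebra+
    moreover have "p'' \<noteq> 0 \<or> q'' \<noteq> 0"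
      using \<open>coprime p'' q''\<close> by auto
    ultimately have "M1 = 0" "M2 = 0"
      by auto
    then have "q'' * (F2 ^ 2 - F1 * F3) = 0" "p'' * (F2 ^ 2 - F1 * F3) = 0"
      unfolding M by algebra+
    then show False
      using res \<open>p'' \<noteq> 0 \<or> q'' \<noteq> 0\<close> by (auto simp: F)
  qed
  show ?thesis
  proof
    show "biquad A p'' q'' p q = G'' * S" "biquad B p'' q'' p q = G'' * T"
      using a b unfolding biquad_commute[OF sym(1), of p''] biquad_commute[OF sym(2), of p'']
      by (simp_all add: ab ab' biquad_def)
  qed (use \<open>coprime p'' q''\<close> \<open>G'' \<noteq> 0\<close> D0 D1 D2 pq'' in \<open>simp_all add: ab F N\<close>)
qed

subsection \<open>Total degree\<close>

lemma (in comm_ring_1_map) map_poly_add: "map_poly h (p + q) = map_poly h p + map_poly h q"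
  by (intro poly_eqI) (simp add: coeff_map_poly zero add)

text \<open>The universal property of the polynomial ring; applied twice, it makes
  \<open>homog\<close> a ring homomorphism.\<close>

lemma (in comm_ring_1_map) comm_ring_1_map_eval: "comm_ring_1_map (\<lambda>p. poly (map_poly h p) x)"
proof
  fix p q
  show "poly (map_poly h (p + q)) x = poly (map_poly h p) x + poly (map_poly h q) x"
    by (simp add: map_poly_add)
  show "poly (map_poly h (p * q)) x = poly (map_poly h p) x * poly (map_poly h q) x"
    by (induction p)
       (simp_all add: map_poly_pCons map_poly_add map_poly_smult zero mult algebra_simps)
qed (simp add: one)

definition cc :: "'a::comm_ring_1 \<Rightarrow> 'a poly poly" where
  "cc c = [:[:c:]:]"

lemma comm_ring_1_map_cc: "comm_ring_1_map cc"
  by unfold_locales (simp_all add: cc_def one_pCons)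

lemma is_unit_cc: "c \<noteq> 0 \<Longrightarrow> is_unit (cc (c :: 'a::field))"
  by (simp add: cc_def dvd_field_iff flip: one_pCons) (simp add: is_unit_const_poly_iff dvd_field_iff)

text \<open>The substitution \<open>x \<mapsto> xy\<close> turns the total degree in \<open>x, y\<close> into the degree in \<open>y\<close>.\<close>

definition subst_inner :: "'a::comm_ring_1 poly \<Rightarrow> 'a poly poly" where
  "subst_inner p = poly (map_poly cc p) [:0, [:0, 1:]:]"

definition homog :: "'a::comm_ring_1 poly poly \<Rightarrow> 'a poly poly" where
  "homog p = poly (map_poly subst_inner p) [:0, 1:]"

lemma comm_ring_1_map_subst_inner: "comm_ring_1_map subst_inner"
  unfolding subst_inner_def by (rule comm_ring_1_map.comm_ring_1_map_eval[OF comm_ring_1_map_cc])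

lemma comm_ring_1_map_homog: "comm_ring_1_map homog"
  unfolding homog_def by (rule comm_ring_1_map.comm_ring_1_map_eval[OF comm_ring_1_map_subst_inner])

lemmas homog_simps = comm_ring_1_map.add[OF comm_ring_1_map_homog]
  comm_ring_1_map.mult[OF comm_ring_1_map_homog] comm_ring_1_map.one[OF comm_ring_1_map_homog]
  comm_ring_1_map.zero[OF comm_ring_1_map_homog] comm_ring_1_map.diff[OF comm_ring_1_map_homog]
  comm_ring_1_map.uminus[OF comm_ring_1_map_homog] comm_ring_1_map.power[OF comm_ring_1_map_homog]

lemma subst_inner_pCons: "subst_inner (pCons c p) = cc c + [:0, [:0, 1:]:] * subst_inner p"
  by (simp add: subst_inner_def map_poly_pCons comm_ring_1_map.zero[OF comm_ring_1_map_cc])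

lemma homog_pCons: "homog (pCons c p) = subst_inner c + [:0, 1:] * homog p"
  by (simp add: homog_def map_poly_pCons comm_ring_1_map.zero[OF comm_ring_1_map_subst_inner])

lemma subst_inner_0 [simp]: "subst_inner 0 = 0" and homog_0 [simp]: "homog 0 = 0"
  by (simp_all add: subst_inner_def homog_def)

lemma coeff_subst_inner: "coeff (subst_inner p) d = monom (coeff p d) d"
proof (induction p arbitrary: d)
  case (pCons c p)
  then show ?case
    by (cases d) (simp_all add: subst_inner_pCons cc_def monom_0 monom_Suc)
qed simp

text \<open>The monomial x^i y^j goes to x^i y^(i+j), so distinct monomials stay distinct and
  nothing cancels.\<close>

lemma coeff_homog: "coeff (coeff (homog p) d) i = (if i \<le> d then coeff (coeff p (d - i)) i else 0)"
proof (induction p arbitrary: d)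
  case (pCons c p)
  show ?case
  proof (cases d)
    case 0
    then show ?thesis
      by (simp add: homog_pCons coeff_subst_inner)
  next
    case (Suc e)
    then show ?thesis
      by (auto simp: homog_pCons coeff_subst_inner pCons.IH coeff_pCons Suc_diff_le le_Suc_eq)
  qed
qed simp

lemma degree_homog_le_iff:
  "degree (homog p) \<le> n \<longleftrightarrow> (\<forall>i j. coeff (coeff p i) j \<noteq> 0 \<longrightarrow> i + j \<le> n)"
proof
  assume le: "degree (homog p) \<le> n"
  show "\<forall>i j. coeff (coeff p i) j \<noteq> 0 \<longrightarrow> i + j \<le> n"
  proof (intro allI impI)
    fix i j assume nz: "coeff (coeff p i) j \<noteq> 0"
    have "coeff (coeff (homog p) (i + j)) j = coeff (coeff p i) j"
      by (simp add: coeff_homog)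
    with nz have "coeff (homog p) (i + j) \<noteq> 0"
      by auto
    then show "i + j \<le> n"
      using le le_degree order_trans by blast
  qed
next
  assume *: "\<forall>i j. coeff (coeff p i) j \<noteq> 0 \<longrightarrow> i + j \<le> n"
  show "degree (homog p) \<le> n"
  proof (rule degree_le, intro allI impI poly_eqI)
    fix d i assume "n < d"
    then have "coeff (coeff p (d - i)) i = 0" if "i \<le> d"
      using *[rule_format, of "d - i" i] that by (metis le_add_diff_inverse2 not_le)
    then show "coeff (coeff (homog p) d) i = coeff 0 i"
      by (simp add: coeff_homog)
  qed
qed

lemma tdeg_le_iff: "tdeg p \<le> n \<longleftrightarrow> (\<forall>i j. coeff (coeff p i) j \<noteq> 0 \<longrightarrow> i + j \<le> n)"
proof -
  have "{degree (coeff p i) + i | i. coeff p i \<noteq> 0} \<subseteq> (\<lambda>i. degree (coeff p i) + i) ` {..degree p}"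
    using le_degree by fastforce
  then have fin: "finite {degree (coeff p i) + i | i. coeff p i \<noteq> 0}"
    using finite_subset by blast
  have "tdeg p \<le> n \<longleftrightarrow> (\<forall>i. coeff p i \<noteq> 0 \<longrightarrow> degree (coeff p i) + i \<le> n)"
    unfolding tdeg_def using fin by (subst Max_le_iff) auto
  also have "\<dots> \<longleftrightarrow> (\<forall>i j. coeff (coeff p i) j \<noteq> 0 \<longrightarrow> i + j \<le> n)"
  proof (intro iffI allI impI)
    fix i j
    assume *: "\<forall>i. coeff p i \<noteq> 0 \<longrightarrow> degree (coeff p i) + i \<le> n" and nz: "coeff (coeff p i) j \<noteq> 0"
    then have "degree (coeff p i) + i \<le> n" "j \<le> degree (coeff p i)"
      using le_degree by force+
    then show "i + j \<le> n" by simp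
  next
    fix i
    assume "\<forall>i j. coeff (coeff p i) j \<noteq> 0 \<longrightarrow> i + j \<le> n" "coeff p i \<noteq> 0"
    then show "degree (coeff p i) + i \<le> n"
      by (metis add.commute leading_coeff_0_iff)
  qed
  finally show ?thesis .
qed

lemma tdeg_eq_degree_homog: "tdeg p = degree (homog p)"
  using tdeg_le_iff[of p] degree_homog_le_iff[of p] by (metis le_antisym order_refl)

lemma homog_eq_0_iff [simp]: "homog p = 0 \<longleftrightarrow> p = 0"
proof
  assume 0: "homog p = 0"
  have "coeff (coeff p i) j = coeff (coeff (homog p) (i + j)) j" for i j
    by (simp add: coeff_homog)
  with 0 show "p = 0"
    by (simp add: poly_eq_iff)
qed simp

lemma tdeg_dvd_le:
  assumes "p dvd q" "q \<noteq> 0"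
  shows "tdeg p \<le> tdeg q"
proof -
  have "homog p dvd homog q"
    using assms(1) by (auto elim!: dvdE simp: homog_simps)
  then show ?thesis
    using assms(2) by (simp add: tdeg_eq_degree_homog dvd_imp_degree_le)
qed

lemma tdeg_is_unit: "is_unit p \<Longrightarrow> tdeg p = 0"
  using tdeg_dvd_le[of p 1] by (simp add: tdeg_eq_degree_homog homog_simps)

lemma tdeg_associated:
  assumes "p dvd q" "q dvd p"
  shows "tdeg p = tdeg q"
  using assms tdeg_dvd_le by (cases "p = 0"; cases "q = 0") (auto intro!: le_antisym)

text \<open>Two coprime representations have associated numerators and associated denominators, and
  associated polynomials have equal total degree; this is the uniqueness behind
  \<open>THE\<close>.\<close>

lemma rf_degree_Fract:
  assumes "coprime p q" "q \<noteq> 0"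
  shows "rf_degree (Fract p q) = max (tdeg p) (tdeg q)"
  unfolding rf_degree_def
proof (rule the_equality)
  show "\<exists>a b. b \<noteq> 0 \<and> coprime a b \<and> Fract p q = Fract a b \<and> max (tdeg p) (tdeg q) = max (tdeg a) (tdeg b)"
    using assms by blast
next
  fix d
  assume "\<exists>a b. b \<noteq> 0 \<and> coprime a b \<and> Fract p q = Fract a b \<and> d = max (tdeg a) (tdeg b)"
  then obtain a b where ab: "b \<noteq> 0" "coprime a b" "Fract p q = Fract a b" "d = max (tdeg a) (tdeg b)"
    by blast
  have eq: "p * b = a * q"
    using ab(1,3) assms(2) by (simp add: eq_fract)
  then have "p dvd a * q" "a dvd p * b" "b dvd a * q" "q dvd p * b"
    by (metis dvd_triv_left dvd_triv_right)+
  then have "p dvd a" "a dvd p" "b dvd q" "q dvd b"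
    using assms(1) ab(2)
    by (simp_all add: coprime_dvd_mult_left_iff coprime_dvd_mult_right_iff coprime_commute)
  then show "d = max (tdeg p) (tdeg q)"
    using ab(4) tdeg_associated by metis
qed

section \<open>Leading coefficients and the degree recursion\<close>

lemma coeff_mult_le:
  assumes "degree p \<le> m" "degree q \<le> n"
  shows "coeff (p * q) (m + n) = coeff p m * coeff q n"
proof (cases "degree p = m \<and> degree q = n")
  case True
  then show ?thesis using coeff_mult_degree_sum[of p q] by auto
next
  case False
  then have "degree p + degree q < m + n" using assms by linarith
  then have "degree (p * q) < m + n" using degree_mult_le[of p q] by linarith
  moreover have "coeff p m = 0 \<or> coeff q n = 0"
    using False assms by (metis coeff_eq_0 le_neq_implies_less)
  ultimately show ?thesis by (auto simp: coeff_eq_0)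
qed

lemma degree_mult_le': "degree p \<le> m \<Longrightarrow> degree q \<le> n \<Longrightarrow> degree (p * q) \<le> m + n"
  using degree_mult_le[of p q] by linarith

lemma quad_vec_top:
  fixes M :: "nat \<Rightarrow> nat \<Rightarrow> 'a::comm_ring_1"
  assumes "degree P \<le> d" "degree Q \<le> d"
  shows "degree (quad_vec (\<lambda>i j. [:M i j:]) P Q i) \<le> d + d"
    and "coeff (quad_vec (\<lambda>i j. [:M i j:]) P Q i) (d + d) = quad_vec M (coeff P d) (coeff Q d) i"
proof -
  show "degree (quad_vec (\<lambda>i j. [:M i j:]) P Q i) \<le> d + d"
    using degree_mult_le'[OF assms(1) assms(1)] degree_mult_le'[OF assms(1) assms(2)]
      degree_mult_le'[OF assms(2) assms(2)]
    by (auto simp: quad_vec_def power2_eq_square intro!: degree_add_le order_trans[OF degree_smult_le])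
  show "coeff (quad_vec (\<lambda>i j. [:M i j:]) P Q i) (d + d) = quad_vec M (coeff P d) (coeff Q d) i"
    by (simp add: quad_vec_def power2_eq_square coeff_mult_le[OF assms(1) assms(1)]
        coeff_mult_le[OF assms(1) assms(2)] coeff_mult_le[OF assms(2) assms(2)])
qed

lemma coeff_max_degree_nonzero:
  assumes "P \<noteq> 0 \<or> Q \<noteq> 0"
  shows "coeff P (max (degree P) (degree Q)) \<noteq> 0 \<or> coeff Q (max (degree P) (degree Q)) \<noteq> 0"
  using assms by (metis coeff_0_degree_minus_1 degree_0 leading_coeff_0_iff max.absorb1 max.absorb2
      max_0L max_0R nle_le)

text \<open>Comparison of the top coefficients on both sides of the factorization in \<open>qrt_step\<close>: neither
  side cancels, on the left because \<open>\<beta>\<^sub>0\<^sub>0\<alpha> - \<alpha>\<^sub>0\<^sub>0\<beta>\<close> is nonsingular.\<close>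

lemma degree_step:
  fixes \<alpha> \<beta> :: "nat \<Rightarrow> nat \<Rightarrow> 'a::idom" and P Q P' Q' P'' Q'' S T :: "'a poly"
  defines "A \<equiv> \<lambda>i j. [:\<alpha> i j:]" and "B \<equiv> \<lambda>i j. [:\<beta> i j:]"
  assumes S: "degree S \<le> 4" "coeff S 4 = \<sigma> * \<alpha> 0 0"
    and T: "degree T \<le> 4" "coeff T 4 = \<sigma> * \<beta> 0 0"
    and \<sigma>: "\<sigma> \<noteq> 0" and det: "det3 (\<lambda>i j. \<beta> 0 0 * \<alpha> i j - \<alpha> 0 0 * \<beta> i j) \<noteq> 0"
    and nz: "P \<noteq> 0 \<or> Q \<noteq> 0" "P' \<noteq> 0 \<or> Q' \<noteq> 0" "P'' \<noteq> 0 \<or> Q'' \<noteq> 0"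
    and eqs: "quad_vec A P Q 0 * T - quad_vec B P Q 0 * S = - (Q' * Q'')"
      "quad_vec A P Q 1 * T - quad_vec B P Q 1 * S = Q' * P'' + P' * Q''"
      "quad_vec A P Q 2 * T - quad_vec B P Q 2 * S = - (P' * P'')"
  shows "max (degree P'') (degree Q'') + max (degree P') (degree Q') =
    2 * max (degree P) (degree Q) + 4"
proof -
  define d d' d'' where d: "d = max (degree P) (degree Q)" "d' = max (degree P') (degree Q')"
    "d'' = max (degree P'') (degree Q'')"
  have le: "degree P \<le> d" "degree Q \<le> d" "degree P' \<le> d'" "degree Q' \<le> d'"
    "degree P'' \<le> d''" "degree Q'' \<le> d''"
    by (simp_all add: d)
  define C where "C i = quad_vec A P Q i * T - quad_vec B P Q i * S" for i
  define M where "M = (\<lambda>i j. \<beta> 0 0 * \<alpha> i j - \<alpha> 0 0 * \<beta> i j)"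
  have C_le: "degree (C i) \<le> d + d + 4" for i
    unfolding C_def A_def B_def
    by (intro degree_diff_le degree_mult_le' quad_vec_top le S T)
  have C_top: "coeff (C i) (d + d + 4) = \<sigma> * quad_vec M (coeff P d) (coeff Q d) i" for i
  proof -
    have "coeff (C i) (d + d + 4) = quad_vec \<alpha> (coeff P d) (coeff Q d) i * (\<sigma> * \<beta> 0 0)
      - quad_vec \<beta> (coeff P d) (coeff Q d) i * (\<sigma> * \<alpha> 0 0)"
      unfolding C_def A_def B_def coeff_diff
      by (simp only: coeff_mult_le quad_vec_top le S T)
    then show ?thesis
      unfolding quad_vec_def M_def by algebra
  qed
  have C_nz: "\<exists>i<3. coeff (C i) (d + d + 4) \<noteq> 0"
  proof (rule ccontr)
    assume "\<not> ?thesis"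
    then have "quad_vec M (coeff P d) (coeff Q d) i = 0" if "i < 3" for i
      using that \<sigma> C_top by auto
    then have "det3 M * coeff P d ^ 2 = 0" "det3 M * coeff Q d ^ 2 = 0"
      unfolding det3_mult_quad_vec[where p = "coeff P d" and q = "coeff Q d"] by simp_all
    then show False
      using det coeff_max_degree_nonzero[OF nz(1)] by (simp add: M_def d)
  qed
  have C012: "C 0 = - (Q' * Q'')" "C 1 = Q' * P'' + P' * Q''" "C 2 = - (P' * P'')"
    using eqs by (simp_all add: C_def)
  have less3: "i = 0 \<or> i = 1 \<or> i = 2" if "i < 3" for i :: nat
    using that by linarith
  have R_le: "degree (C i) \<le> d' + d''" if "i < 3" for i
    using less3[OF that] degree_mult_le' le
    by (auto simp: C012 intro!: degree_add_le)
  \<comment> \<open>The top coefficients are, up to sign, those of a product of two nonzero linear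
    forms, which is nonzero over a domain. So \<open>d' + d''\<close> and \<open>d + d + 4\<close>
    are both sharp bounds for the degrees of the \<open>C i\<close>.\<close>
  have R_nz: "\<exists>i<3. coeff (C i) (d' + d'') \<noteq> 0"
  proof (rule ccontr)
    assume "\<not> ?thesis"
    then have "coeff (C 0) (d' + d'') = 0" "coeff (C 1) (d' + d'') = 0" "coeff (C 2) (d' + d'') = 0"
      by simp_all
    then have "coeff Q' d' * coeff Q'' d'' = 0" "coeff P' d' * coeff P'' d'' = 0"
      "coeff Q' d' * coeff P'' d'' + coeff P' d' * coeff Q'' d'' = 0"
      by (simp_all add: C012 coeff_mult_le le)
    then show False
      using coeff_max_degree_nonzero[OF nz(2)] coeff_max_degree_nonzero[OF nz(3)]
      by (auto simp: d)
  qed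
  have "d' + d'' = d + d + 4"
  proof (rule linorder_cases)
    assume "d' + d'' < d + d + 4"
    then have "coeff (C i) (d + d + 4) = 0" if "i < 3" for i
      using R_le[OF that] by (simp add: coeff_eq_0)
    then show ?thesis using C_nz by blast
  next
    assume "d + d + 4 < d' + d''"
    then have "coeff (C i) (d' + d'') = 0" if "i < 3" for i
      using C_le[of i] by (simp add: coeff_eq_0)
    then show ?thesis using R_nz by blast
  qed
  then show ?thesis by (simp add: d)
qed

subsection \<open>The symmetric QRT map\<close>

abbreviation const_mat :: "(nat \<Rightarrow> nat \<Rightarrow> 'a) \<Rightarrow> nat \<Rightarrow> nat \<Rightarrow> 'a::comm_ring_1 poly poly" where
  "const_mat M \<equiv> \<lambda>i j. cc (M i j)"

abbreviation "var0 \<equiv> [:[:0, 1:]:]"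
abbreviation "var1 \<equiv> [:0, 1:]"

definition invariant_form :: "(nat \<Rightarrow> nat \<Rightarrow> 'a) \<Rightarrow> 'a::comm_ring_1 poly poly" where
  "invariant_form M = biquad (const_mat M) var1 1 var0 1"

lemma comm_ring_1_map_const_poly: "comm_ring_1_map (\<lambda>c. [:c:])"
  by unfold_locales (simp_all add: one_pCons)

lemma is_sym_const_mat: "is_sym M \<Longrightarrow> is_sym (const_mat M)"
  by (simp add: is_sym_def)

lemma minors_eq_quad_res:
  "minor 2 0 A B p q ^ 2 - minor 1 2 A B p q * minor 0 1 A B p q =
    quad_res (quad_vec A p q 0) (quad_vec A p q 1) (quad_vec A p q 2)
      (quad_vec B p q 0) (quad_vec B p q 1) (quad_vec B p q 2)"
  by (simp add: minor_def quad_res_def)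

lemma is_unit_const_mat:
  fixes A B :: "nat \<Rightarrow> nat \<Rightarrow> 'a::field"
  assumes "generic_pair A B"
  shows "is_unit (det3 (const_mat A))" "is_unit (adj_skew (const_mat A) (const_mat A))"
    "is_unit (pencil_res (const_mat A) (const_mat B))"
  using assms
  by (simp_all add: generic_pair_def is_unit_cc flip: comm_ring_1_map.det_cols[OF comm_ring_1_map_cc]
      comm_ring_1_map.adj_skew[OF comm_ring_1_map_cc] comm_ring_1_map.pencil_res[OF comm_ring_1_map_cc])

text \<open>Modulo \<open>q\<close> the coefficients become multiples of \<open>P\<close>, and the
  resultant is homogeneous of degree 4 in all six.\<close>

lemma dvd_quad_res_diff:
  fixes q :: "'a::comm_ring_1"
  shows "q dvd quad_res (a0 * P + q * r0) (a1 * P + q * r1) (a2 * P + q * r2)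
      (b0 * P + q * s0) (b1 * P + q * s1) (b2 * P + q * s2) - quad_res a0 a1 a2 b0 b1 b2 * P ^ 4"
proof -
  have minor: "\<exists>t. (a * P + q * r) * (b * P + q * s) - (c * P + q * u) * (d * P + q * v)
      = (a * b - c * d) * P ^ 2 + q * t" for a b c d r s u v
    by (rule exI[of _ "a * P * s + r * b * P + q * r * s - c * P * v - u * d * P - q * u * v"])
       (simp add: algebra_simps power2_eq_square)
  obtain t2 where t2: "(a2 * P + q * r2) * (b0 * P + q * s0) - (a0 * P + q * r0) * (b2 * P + q * s2)
      = (a2 * b0 - a0 * b2) * P ^ 2 + q * t2"
    using minor by blast
  obtain t1 where t1: "(a1 * P + q * r1) * (b2 * P + q * s2) - (a2 * P + q * r2) * (b1 * P + q * s1)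
      = (a1 * b2 - a2 * b1) * P ^ 2 + q * t1"
    using minor by blast
  obtain t3 where t3: "(a0 * P + q * r0) * (b1 * P + q * s1) - (a1 * P + q * r1) * (b0 * P + q * s0)
      = (a0 * b1 - a1 * b0) * P ^ 2 + q * t3"
    using minor by blast
  have "\<exists>t. (x * P ^ 2 + q * t2) ^ 2 - (y * P ^ 2 + q * t1) * (z * P ^ 2 + q * t3)
      = (x ^ 2 - y * z) * P ^ 4 + q * t" for x y z
    by (rule exI[of _ "2 * x * P ^ 2 * t2 + q * t2 ^ 2 - y * P ^ 2 * t3 - t1 * z * P ^ 2 - q * t1 * t3"])
       (simp add: algebra_simps power2_eq_square power4_eq_xxxx)
  then show ?thesis
    unfolding quad_res_def t1 t2 t3 by (metis add_diff_cancel_left' dvd_triv_left)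
qed

text \<open>The resultant of the two quadratics \<open>A V(p,q)\<close> and \<open>B V(p,q)\<close> is a binary form of degree 8 in
  \<open>p, q\<close> whose extreme coefficients are the two constants below, so its vanishing would force
  the coprime \<open>p\<close> and \<open>q\<close> to be constant.\<close>

lemma quad_res_nonzero:
  fixes A B :: "nat \<Rightarrow> nat \<Rightarrow> 'a::field_gcd"
  assumes gen: "generic_pair A B" and cop: "coprime p q" and nonconst: "\<not> (is_unit p \<and> is_unit q)"
  defines "A' \<equiv> const_mat A" and "B' \<equiv> const_mat B"
  shows "quad_res (quad_vec A' p q 0) (quad_vec A' p q 1) (quad_vec A' p q 2)
    (quad_vec B' p q 0) (quad_vec B' p q 1) (quad_vec B' p q 2) \<noteq> 0" (is "?R \<noteq> 0")
proof
  assume 0: "?R = 0"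
  \<comment> \<open>Once the resultant is zero, \<open>y\<close> divides a nonzero constant times a
    power of \<open>x\<close>, to which it is coprime. This serves for (x, y) = (p, q) with row 0
    and for (q, p) with row 2.\<close>
  have unit: "is_unit y"
    if "y dvd ?R - quad_res (A' k 0) (A' k 1) (A' k 2) (B' k 0) (B' k 1) (B' k 2) * (x ^ 2) ^ 4"
      and xy: "coprime x y" and k: "k = 0 \<or> k = 2" for x y k
  proof -
    let ?c = "quad_res (A k 0) (A k 1) (A k 2) (B k 0) (B k 1) (B k 2)"
    have "?c \<noteq> 0"
      using gen k by (auto simp: generic_pair_def)
    moreover have "y dvd cc ?c * (x ^ 2) ^ 4"
      using that(1) unfolding 0 by (simp add: A'_def B'_def flip: comm_ring_1_map.quad_res[OF comm_ring_1_map_cc])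
    moreover have "coprime y ((x ^ 2) ^ 4)"
      using xy by (simp add: coprime_commute)
    ultimately show ?thesis
      using is_unit_cc[of ?c] coprime_dvd_mult_left_iff dvd_unit_imp_unit by blast
  qed
  have sym: "A' 1 0 = A' 0 1" "A' 2 0 = A' 0 2" "A' 2 1 = A' 1 2"
    "B' 1 0 = B' 0 1" "B' 2 0 = B' 0 2" "B' 2 1 = B' 1 2"
    using gen by (simp_all add: generic_pair_def is_sym_def A'_def B'_def)
  have vec: "quad_vec M p q i = M i 0 * p ^ 2 + q * (M i 1 * p + M i 2 * q)"
    "quad_vec M p q i = M i 2 * q ^ 2 + p * (M i 0 * p + M i 1 * q)"
    for M :: "nat \<Rightarrow> nat \<Rightarrow> 'a poly poly" and i
    by (simp_all add: quad_vec_def algebra_simps power2_eq_square)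
  have "q dvd ?R - quad_res (A' 0 0) (A' 0 1) (A' 0 2) (B' 0 0) (B' 0 1) (B' 0 2) * (p ^ 2) ^ 4"
    unfolding vec(1) sym by (rule dvd_quad_res_diff)
  then have "is_unit q"
    using unit cop by blast
  have "p dvd ?R - quad_res (A' 2 0) (A' 2 1) (A' 2 2) (B' 2 0) (B' 2 1) (B' 2 2) * (q ^ 2) ^ 4"
    unfolding vec(2) sym by (rule dvd_quad_res_diff)
  then have "is_unit p"
    using unit cop coprime_commute by blast
  with \<open>is_unit q\<close> nonconst show False by blast
qed

text \<open>Both forms are quadratics in \<open>var1\<close> with coefficient vectors A V(u0,1) and
  B V(u0,1). A common prime divides their nonzero resultant, so it is free of \<open>var1\<close>
  and divides every coefficient A V(u0,1); the last entry of V being 1, it divides the unit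
  \<open>det3 A'\<close>.\<close>

lemma coprime_invariant_forms:
  fixes A B :: "nat \<Rightarrow> nat \<Rightarrow> 'a::field_gcd"
  assumes gen: "generic_pair A B"
  shows "coprime (invariant_form A) (invariant_form B)"
proof -
  define A' B' where "A' = const_mat A" and "B' = const_mat B"
  define a b where "a = quad_vec A' var0 1" and "b = quad_vec B' var0 1"
  have sym: "is_sym A'" "is_sym B'"
    using gen by (simp_all add: A'_def B'_def generic_pair_def is_sym_const_mat)
  have forms: "invariant_form A = a 0 * var1 ^ 2 + a 1 * var1 + a 2"
    "invariant_form B = b 0 * var1 ^ 2 + b 1 * var1 + b 2"
    using biquad_commute[OF sym(1), of var1 1 var0 1] biquad_commute[OF sym(2), of var1 1 var0 1]
    by (simp_all add: invariant_form_def a_def b_def A'_def B'_def biquad_def)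
  define c where "c M i = quad_vec (\<lambda>i j. [:M i j:]) [:0, 1:] 1 i" for M :: "nat \<Rightarrow> nat \<Rightarrow> 'a" and i
  have const: "a i = [:c A i:]" "b i = [:c B i:]" for i
    by (simp_all add: a_def b_def c_def A'_def B'_def quad_vec_def cc_def power2_eq_square)
  have form_A: "invariant_form A = [:c A 2, c A 1, c A 0:]"
    unfolding forms const by (simp add: power2_eq_square)
  let ?R = "quad_res (a 0) (a 1) (a 2) (b 0) (b 1) (b 2)"
  have "\<not> is_unit (var0 :: 'a poly poly)"
    by (simp add: is_unit_const_poly_iff is_unit_iff_degree)
  then have R_nz: "?R \<noteq> 0"
    using quad_res_nonzero[OF gen, of var0 1] by (simp add: a_def b_def A'_def B'_def)
  show ?thesis
  proof (rule coprime_if_no_prime)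
    fix \<pi> assume \<pi>: "prime_elem \<pi>" and dvd: "\<pi> dvd invariant_form A" "\<pi> dvd invariant_form B"
    define S T where "S = invariant_form A" and "T = invariant_form B"
    have ST: "\<pi> dvd S" "\<pi> dvd T" "S = a 0 * var1 ^ 2 + a 1 * var1 + a 2"
      "T = b 0 * var1 ^ 2 + b 1 * var1 + b 2"
      using dvd forms by (simp_all add: S_def T_def)
    define Z where "Z = a 1 * T - b 1 * S"
    define W where "W = a 0 * T - b 0 * S"
    have "\<pi> dvd W" "\<pi> dvd Z"
      using ST(1,2) by (simp_all add: W_def Z_def)
    moreover have "?R = - (a 2 * b 0 - a 0 * b 2) * W - (a 0 * b 1 - a 1 * b 0) * (Z + var1 * W)"
      unfolding quad_res_def Z_def W_def ST(3,4) by algebra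
    ultimately have "\<pi> dvd ?R"
      by (simp only: dvd_diff dvd_add dvd_mult)
    moreover have "degree ?R = 0"
      unfolding const comm_ring_1_map.quad_res[OF comm_ring_1_map_const_poly, symmetric] by simp
    ultimately have "degree \<pi> = 0"
      using R_nz dvd_imp_degree_le[of \<pi> ?R] by simp
    then obtain \<pi>' where \<pi>': "\<pi> = [:\<pi>':]"
      by (metis degree_eq_zeroE)
    have "\<pi>' dvd c A i" if "i \<in> {0, 1, 2}" for i
    proof -
      have "\<pi>' dvd coeff [:c A 2, c A 1, c A 0:] n" for n
        using dvd(1) \<pi>' unfolding form_A by (simp add: const_poly_dvd_iff)
      from this[of 0] this[of "Suc 0"] this[of "Suc (Suc 0)"] that show ?thesis
        by auto
    qed
    then have "\<pi> dvd a 0" "\<pi> dvd a 1" "\<pi> dvd a 2"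
      by (simp_all add: \<pi>' const)
    then have "\<pi> dvd det3 A' * 1 ^ 2"
      unfolding det3_mult_quad_vec(2)[where p = var0 and q = 1] by (simp add: a_def)
    then have "\<pi> dvd det3 A'"
      by simp
    then show False
      using \<pi> is_unit_const_mat(1)[OF gen] dvd_unit_imp_unit prime_elem_not_unit
      unfolding A'_def by blast
  next
    show "invariant_form A \<noteq> 0 \<or> invariant_form B \<noteq> 0"
    proof (rule ccontr)
      assume "\<not> ?thesis"
      then have "[:c A 2, c A 1, c A 0:] = 0"
        using form_A by simp
      then have "c A 0 = 0" "c A 1 = 0" "c A 2 = 0"
        by simp_all
      then show False
        using R_nz by (simp add: const quad_res_def)
    qed
  qed
qed

lemma homog_cc: "homog (cc k) = [:[:k:]:]"
  and homog_var0: "homog var0 = [:0, [:0, 1:]:]"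
  and homog_var1: "homog var1 = [:0, 1:]"
  by (simp_all add: cc_def homog_pCons subst_inner_pCons comm_ring_1_map.one[OF comm_ring_1_map_homog]
      comm_ring_1_map.one[OF comm_ring_1_map_subst_inner] flip: one_pCons)

lemma homog_quad_vec:
  "homog (quad_vec (const_mat M) p q i) = quad_vec (\<lambda>i j. [:[:M i j:]:]) (homog p) (homog q) i"
  by (simp add: quad_vec_def homog_simps homog_cc)

text \<open>The only monomial of total degree 4 is u0^2 u1^2, with coefficient \<open>M 0 0\<close>;
  the substitution sends it to x^2 y^4.\<close>

lemma homog_invariant_form:
  shows "degree (homog (invariant_form M)) \<le> 4"
    and "coeff (homog (invariant_form M)) 4 = [:0, 0, 1:] * [:M 0 0:]"
proof -
  have four: "(4 :: nat) = Suc (Suc (Suc (Suc 0)))"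
    by simp
  have "homog (invariant_form M) = [:[:M 2 2:], [:M 2 1:] + [:0, M 1 2:], [:M 2 0:] + [:0, M 1 1:] + [:0, 0, M 0 2:],
      [:0, M 1 0:] + [:0, 0, M 0 1:], [:0, 0, M 0 0:]:]"
    by (simp only: invariant_form_def biquad_def homog_simps homog_quad_vec homog_var0 homog_var1
        homog_cc quad_vec_def) (simp add: power2_eq_square algebra_simps)
  then show "degree (homog (invariant_form M)) \<le> 4"
    "coeff (homog (invariant_form M)) 4 = [:0, 0, 1:] * [:M 0 0:]"
    by (auto simp: four degree_pCons_eq_if)
qed

lemma tdeg_var: "tdeg var0 = 1" "tdeg var1 = 1" "tdeg 1 = 0"
  by (simp_all add: tdeg_eq_degree_homog homog_var0 homog_var1 homog_simps)

section \<open>From reduced polynomial pairs to the recurrence\<close>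

lemma cst_eq: "cst c = to_fract (cc c)"
  by (simp add: cst_def cc_def to_fract_def)

lemma matvec_eq:
  assumes "q \<noteq> 0"
  shows "matvec M (to_fract p / to_fract q) i = to_fract (quad_vec (const_mat M) p q i) / to_fract q ^ 2"
proof -
  have field: "a * (x / y) ^ 2 + b * (x / y) + c = (a * x ^ 2 + b * (x * y) + c * y ^ 2) / y ^ 2"
    if "y \<noteq> 0" for a b c x y :: ratfun
    using that by (simp add: field_simps power2_eq_square)
  have "{..<3} = {0, 1, 2 :: nat}"
    by auto
  then show ?thesis
    using field[of "to_fract q" "cst (M i 0)" "to_fract p" "cst (M i 1)" "cst (M i 2)"] assms
    by (simp add: matvec_def Vvec_def quad_vec_def cst_eq comm_ring_1_map.power[OF comm_ring_1_map_to_fract]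
        add.assoc)
qed

lemma f_eq:
  assumes "q \<noteq> 0" and u: "u = to_fract p / to_fract q"
  shows "f1 u = to_fract (minor 1 2 (const_mat matA) (const_mat matB) p q) / to_fract q ^ 4"
    and "f2 u = to_fract (minor 2 0 (const_mat matA) (const_mat matB) p q) / to_fract q ^ 4"
    and "f3 u = to_fract (minor 0 1 (const_mat matA) (const_mat matB) p q) / to_fract q ^ 4"
  unfolding u f1_def f2_def f3_def matvec_eq[OF assms(1)]
  by (simp_all add: minor_def diff_divide_distrib flip: power_add)

text \<open>The induction carries two consecutive iterates in lowest terms, the conserved ratio with
  its cofactor \<open>G\<close>, and both degrees. The degree formula is additive to avoid truncated
  subtraction.\<close>

lemma qrt_reduced:
  "\<exists>p' q' p q G. qrt n = to_fract p' / to_fract q' \<and> qrt (Suc n) = to_fract p / to_fract q \<and>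
     q' \<noteq> 0 \<and> q \<noteq> 0 \<and> coprime p' q' \<and> coprime p q \<and> G \<noteq> 0 \<and>
     biquad (const_mat matA) p q p' q' = G * invariant_form matA \<and>
     biquad (const_mat matB) p q p' q' = G * invariant_form matB \<and>
     max (tdeg p') (tdeg q') + 2 * n = 2 * n ^ 2 + 1 \<and>
     max (tdeg p) (tdeg q) + 2 * Suc n = 2 * Suc n ^ 2 + 1"
proof (induction n)
  case 0
  have "qrt 0 = to_fract var0 / to_fract 1" "qrt (Suc 0) = to_fract var1 / to_fract 1"
    by (simp_all add: U0_def U1_def to_fract_def)
  then show ?case
    by (intro exI[of _ var0] exI[of _ 1] exI[of _ var1])
       (simp add: invariant_form_def tdeg_var)
next
  case (Suc n)
  define A B where "A = const_mat matA" and "B = const_mat matB"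
  define S T where "S = invariant_form matA" and "T = invariant_form matB"
  note gen = generic_pair_matA_matB
  from Suc obtain p' q' p q G where
    qrt: "qrt n = to_fract p' / to_fract q'" "qrt (Suc n) = to_fract p / to_fract q"
    and nz: "q' \<noteq> 0" "q \<noteq> 0" "G \<noteq> 0" and cop: "coprime p' q'" "coprime p q"
    and inv: "biquad A p q p' q' = G * S" "biquad B p q p' q' = G * T"
    and deg: "max (tdeg p') (tdeg q') + 2 * n = 2 * n ^ 2 + 1"
      "max (tdeg p) (tdeg q) + 2 * Suc n = 2 * Suc n ^ 2 + 1"
    unfolding A_def B_def S_def T_def by blast
  have sym: "is_sym A" "is_sym B"
    using gen by (simp_all add: A_def B_def generic_pair_def is_sym_const_mat)
  have copST: "coprime S T"
    unfolding S_def T_def by (rule coprime_invariant_forms[OF gen])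
  have top: "degree (homog S) \<le> 4" "coeff (homog S) 4 = [:0, 0, 1:] * [:matA 0 0:]"
    "degree (homog T) \<le> 4" "coeff (homog T) 4 = [:0, 0, 1:] * [:matB 0 0:]"
    unfolding S_def T_def by (rule homog_invariant_form)+
  have "S \<noteq> 0"
    using top(2) gen by (auto simp: generic_pair_def)
  \<comment> \<open>The degree given by the induction hypothesis is positive, so the current iterate
    is not constant.\<close>
  have "\<not> (is_unit p \<and> is_unit q)"
    using deg(2) tdeg_is_unit[of p] tdeg_is_unit[of q] by (auto simp: power2_eq_square)
  then have res: "minor 2 0 A B p q ^ 2 - minor 1 2 A B p q * minor 0 1 A B p q \<noteq> 0"
    unfolding minors_eq_quad_res A_def B_def by (rule quad_res_nonzero[OF gen cop(2)])
  obtain p'' q'' G'' where step: "coprime p'' q''" "G'' \<noteq> 0"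
    "biquad A p'' q'' p q = G'' * S" "biquad B p'' q'' p q = G'' * T"
    "G * p'' = minor 1 2 A B p q * q' - p' * minor 2 0 A B p q"
    "G * q'' = minor 2 0 A B p q * q' - p' * minor 0 1 A B p q"
    "quad_vec A p q 0 * T - quad_vec B p q 0 * S = - (q' * q'')"
    "quad_vec A p q 1 * T - quad_vec B p q 1 * S = q' * p'' + p' * q''"
    "quad_vec A p q 2 * T - quad_vec B p q 2 * S = - (p' * p'')"
    using qrt_step[OF sym _ _ _ cop(2,1) copST \<open>S \<noteq> 0\<close> nz(3) inv res]
      is_unit_const_mat[OF gen] unfolding A_def B_def by blast
  have "p'' \<noteq> 0 \<or> q'' \<noteq> 0"
    using step(1) by auto
  have det: "det3 (\<lambda>i j. [:matB 0 0:] * [:matA i j:] - [:matA 0 0:] * [:matB i j:]) \<noteq> 0"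
  proof -
    have "det3 (\<lambda>i j. [:matB 0 0:] * [:matA i j:] - [:matA 0 0:] * [:matB i j:])
        = [:det3 (\<lambda>i j. matB 0 0 * matA i j - matA 0 0 * matB i j):]"
      unfolding comm_ring_1_map.det_cols[OF comm_ring_1_map_const_poly]
      by (simp add: mult.commute)
    then show ?thesis
      using gen by (simp add: generic_pair_def)
  qed
  have "max (degree (homog p'')) (degree (homog q'')) + max (degree (homog p')) (degree (homog q'))
      = 2 * max (degree (homog p)) (degree (homog q)) + 4"
  proof (rule degree_step[where S = "homog S" and T = "homog T", OF top _ det])
    show "homog p \<noteq> 0 \<or> homog q \<noteq> 0" "homog p' \<noteq> 0 \<or> homog q' \<noteq> 0"
      "homog p'' \<noteq> 0 \<or> homog q'' \<noteq> 0"
      using nz \<open>p'' \<noteq> 0 \<or> q'' \<noteq> 0\<close> by simp_all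
  qed (use step(7-9)[THEN arg_cong[where f = homog]] in
        \<open>simp_all add: homog_simps homog_quad_vec A_def B_def\<close>)
  then have deg'': "max (tdeg p'') (tdeg q'') + max (tdeg p') (tdeg q') = 2 * max (tdeg p) (tdeg q) + 4"
    by (simp add: tdeg_eq_degree_homog)
  then have deg3: "max (tdeg p'') (tdeg q'') + 2 * Suc (Suc n) = 2 * Suc (Suc n) ^ 2 + 1"
    using deg by (simp add: power2_eq_square algebra_simps)
  \<comment> \<open>If \<open>q''\<close> were zero, coprimality would make \<open>p''\<close> a
    unit, against the positive degree just computed.\<close>
  have "q'' \<noteq> 0"
  proof
    assume "q'' = 0"
    then have "tdeg p'' = 0"
      using step(1) by (simp add: tdeg_is_unit)
    moreover have "tdeg q'' = 0"
      using \<open>q'' = 0\<close> by (simp add: tdeg_eq_degree_homog)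
    ultimately have "max (tdeg p'') (tdeg q'') = 0"
      by simp
    with deg3 show False
      by (simp add: power2_eq_square)
  qed
  have "qrt (Suc (Suc n)) = to_fract p'' / to_fract q''"
  proof -
    let ?F = "\<lambda>i j. to_fract (minor i j A B p q)"
    have G: "to_fract G * to_fract p'' = ?F 1 2 * to_fract q' - to_fract p' * ?F 2 0"
      "to_fract G * to_fract q'' = ?F 2 0 * to_fract q' - to_fract p' * ?F 0 1"
      using step(5,6)[THEN arg_cong[where f = to_fract]] by simp_all
    have "qrt (Suc (Suc n)) = (?F 1 2 / to_fract q ^ 4 - to_fract p' / to_fract q' * (?F 2 0 / to_fract q ^ 4))
        / (?F 2 0 / to_fract q ^ 4 - to_fract p' / to_fract q' * (?F 0 1 / to_fract q ^ 4))"
      by (simp add: qrt Let_def f_eq[OF nz(2) refl] A_def B_def mult.commute)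
    also have "\<dots> = ((?F 1 2 * to_fract q' - to_fract p' * ?F 2 0) / (to_fract q' * to_fract q ^ 4))
        / ((?F 2 0 * to_fract q' - to_fract p' * ?F 0 1) / (to_fract q' * to_fract q ^ 4))"
      using nz by (simp add: diff_divide_distrib mult.commute)
    also have "\<dots> = (to_fract G * to_fract p'') / (to_fract G * to_fract q'')"
      using nz unfolding G by simp
    also have "\<dots> = to_fract p'' / to_fract q''"
      using nz by simp
    finally show ?thesis .
  qed
  then show ?case
    using qrt(2) nz(2) \<open>q'' \<noteq> 0\<close> cop(2) step(1-4) deg(2) deg3
    unfolding A_def B_def S_def T_def by blast
qed

theorem theorem9:
  fixes n :: nat
  shows "rf_degree (qrt n) = 2 * n ^ 2 - 2 * n + 1"
proof -
  obtain p q where "qrt n = to_fract p / to_fract q" "q \<noteq> 0" "coprime p q"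
    and deg: "max (tdeg p) (tdeg q) + 2 * n = 2 * n ^ 2 + 1"
    using qrt_reduced[of n] by blast
  then have "rf_degree (qrt n) = max (tdeg p) (tdeg q)"
    by (simp add: rf_degree_Fract flip: Fract_conv_to_fract)
  also have "\<dots> = 2 * n ^ 2 - 2 * n + 1"
    \<comment> \<open>The bound n \<le> n^2 makes the truncated subtraction exact; the power bound
      requires n \<ge> 1, hence the case split.\<close>
    using deg self_le_power[of n 2] by (cases "n = 0") simp_all
  finally show ?thesis .
qed

end
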